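(* Let $(v_j)_{j=1}^n$ be a spherical $(t,t)$-design of $n$ vectors for $\mathbb{C}^d$, and let $0\le k\le 2t+1$. Let $\omega_{k+1}:=e^{2\pi i/(k+1)}$. Then $$(\omega_{k+1}^a v_j)_{0\le a\le k,\ 1\le j\le n}$$ is a spherical $k$-design of $(k+1)n$ vectors for $\mathbb{C}^d$, and hence (under the identification $\mathbb{C}^d\cong\mathbb{R}^{2d}$) a real spherical $k$-design for $\mathbb{R}^{2d}$.
   Context: $\mathbb{S}$ is the unit sphere of $\mathbb{C}^d$ and $\sigma$ the normalised surface measure. $H(p,q)$ is the space of harmonic polynomials on $\mathbb{C}^d$ homogeneous of degree $p$ in $z$ and degree $q$ in $\overline z$, as functions on $\mathbb{S}$. A finite sequence $X$ of points in $\mathbb{S}$ is a spherical $\tau$-design ($\tau\subset\mathbb{N}^2$) if $\frac1{|X|}\sum_{x\in X}f(x)=\int_{\mathbb{S}}f\,d\sigma$ for all $f\in\bigoplus_{(p,q)\in\tau}H(p,q)$. A spherical $(t,t)$-design is a $\tau$-design with $\tau\supset\{(0,0),(1,1),\dots,(t,t)\}$ (equivalently it integrates all polynomials homogeneous of degree $t$ in $z$ and degree $t$ in $\overline z$). A spherical $k$-design for $\mathbb{C}^d$ is a $\tau$-design with $\tau\supset\{(p,q):p+q\le k\}$, i.e. it integrates all polynomials of degree $\le k$ in the real coordinates; a real spherical $k$-design for $\mathbb{R}^{2d}$ is a finite sequence on the unit sphere of $\mathbb{R}^{2d}$ whose average equals the normalised surface integral for every real polynomial of degree $\le k$. *)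

theory Defs
  imports "HOL-Analysis.Analysis" "HOL-Probability.Probability"
begin

text \<open>
  Normalised surface measure on the unit sphere, as a Borel measure on the ambient space: the
  image of the uniform distribution on the unit ball under \<open>x \<mapsto> x / |x|\<close>.
  Thus a Borel set \<open>A\<close> of unit vectors has measure
  \<open>vol {r x | 0 < r < 1, x \<in> A} / vol (ball 0 1)\<close>.
\<close>

definition sphere_measure :: "'a::euclidean_space measure" where
  "sphere_measure = distr (uniform_measure lborel (ball 0 1)) borel sgn"

lemma prob_space_sphere_measure: "prob_space (sphere_measure :: 'a::euclidean_space measure)"
proof -
  have m: "emeasure lborel (ball (0::'a) 1) \<noteq> \<infinity>"
    using emeasure_lborel_ball_finite[of "0::'a" 1] by auto
  have "measure lborel (ball (0::'a) 1) > 0"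
    by (rule content_ball_pos) simp
  then have "emeasure lborel (ball (0::'a) 1) \<noteq> 0"
    by (auto simp: measure_def)
  then have "prob_space (uniform_measure lborel (ball (0::'a) 1))"
    using m by (intro prob_space_uniform_measure)
  then show ?thesis
    unfolding sphere_measure_def
    by (rule prob_space.prob_space_distr) (simp add: sgn_div_norm[abs_def])
qed

lemma AE_sphere_measure: "AE x in (sphere_measure :: 'a::euclidean_space measure). x \<in> sphere 0 1"
proof -
  have "AE x in lborel. x \<noteq> (0::'a)"
    by (rule AE_I[where N = "{0}"]) auto
  then have "AE x in uniform_measure lborel (ball (0::'a) 1). sgn x \<in> sphere 0 1"
    by (intro AE_uniform_measureI) (auto simp: norm_sgn elim: eventually_mono)
  then show ?thesis
    unfolding sphere_measure_def
    by (subst AE_distr_iff) (auto simp: sgn_div_norm[abs_def])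
qed

definition laplacian :: "('a::euclidean_space \<Rightarrow> 'b::real_normed_vector) \<Rightarrow> 'a \<Rightarrow> 'b" where
  "laplacian f x =
    (\<Sum>b\<in>Basis. vector_derivative
      (\<lambda>s. vector_derivative (\<lambda>r. f (x + r *\<^sub>R b)) (at s)) (at 0))"

text \<open>
  Polynomial functions on \<open>\<complex>\<^sup>d\<close> that are homogeneous of degree \<open>p\<close> in
  \<open>z\<close> and of degree \<open>q\<close> in the conjugate of \<open>z\<close>.
\<close>

definition bihom_polys :: "nat \<Rightarrow> nat \<Rightarrow> (complex^'d \<Rightarrow> complex) set" where
  "bihom_polys p q =
    {f. \<exists>c :: ('d \<Rightarrow> nat) \<Rightarrow> ('d \<Rightarrow> nat) \<Rightarrow> complex.
      f = (\<lambda>z. \<Sum>\<alpha> | sum \<alpha> UNIV = p. \<Sum>\<beta> | sum \<beta> UNIV = q.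
        c \<alpha> \<beta> * (\<Prod>i\<in>UNIV. (z $ i) ^ \<alpha> i) * (\<Prod>i\<in>UNIV. cnj (z $ i) ^ \<beta> i))}"

text \<open>
  The elements of \<open>H(p,q)\<close> are kept as functions on all of \<open>\<complex>\<^sup>d\<close>; the design
  conditions below depend only on their restrictions to the unit sphere.
\<close>

definition harmonic_polys :: "nat \<Rightarrow> nat \<Rightarrow> (complex^'d \<Rightarrow> complex) set" where
  "harmonic_polys p q = {f \<in> bihom_polys p q. \<forall>z. laplacian f z = 0}"

definition harmonic_sum :: "(nat \<times> nat) set \<Rightarrow> (complex^'d \<Rightarrow> complex) set" where
  "harmonic_sum \<tau> =
    {f. \<exists>F g. finite F \<and> F \<subseteq> \<tau> \<and> (\<forall>(p, q)\<in>F. g (p, q) \<in> harmonic_polys p q) \<and>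
      f = (\<lambda>z. \<Sum>pq\<in>F. g pq z)}"

text \<open>A finite sequence of points is a family \<open>x\<close> over a finite index set \<open>I\<close>.\<close>

definition tau_design :: "(nat \<times> nat) set \<Rightarrow> 'i set \<Rightarrow> ('i \<Rightarrow> complex^'d) \<Rightarrow> bool" where
  "tau_design \<tau> I x \<longleftrightarrow>
    finite I \<and> I \<noteq> {} \<and> (\<forall>i\<in>I. x i \<in> sphere 0 1) \<and>
    (\<forall>f\<in>harmonic_sum \<tau>.
      1 / of_nat (card I) * (\<Sum>i\<in>I. f (x i)) = (LINT z|sphere_measure. f z))"

definition tt_design :: "nat \<Rightarrow> 'i set \<Rightarrow> ('i \<Rightarrow> complex^'d) \<Rightarrow> bool" where
  "tt_design t I x \<longleftrightarrow> (\<exists>\<tau>. {(s, s) | s. s \<le> t} \<subseteq> \<tau> \<and> tau_design \<tau> I x)"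

definition complex_design :: "nat \<Rightarrow> 'i set \<Rightarrow> ('i \<Rightarrow> complex^'d) \<Rightarrow> bool" where
  "complex_design k I x \<longleftrightarrow> (\<exists>\<tau>. {(p, q). p + q \<le> k} \<subseteq> \<tau> \<and> tau_design \<tau> I x)"

definition real_polys :: "nat \<Rightarrow> (real^'m \<Rightarrow> real) set" where
  "real_polys k =
    {f. \<exists>c :: ('m \<Rightarrow> nat) \<Rightarrow> real.
      f = (\<lambda>x. \<Sum>\<alpha> | sum \<alpha> UNIV \<le> k. c \<alpha> * (\<Prod>i\<in>UNIV. (x $ i) ^ \<alpha> i))}"

definition real_design :: "nat \<Rightarrow> 'i set \<Rightarrow> ('i \<Rightarrow> real^'m) \<Rightarrow> bool" where
  "real_design k I x \<longleftrightarrow>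
    finite I \<and> I \<noteq> {} \<and> (\<forall>i\<in>I. x i \<in> sphere 0 1) \<and>
    (\<forall>f\<in>real_polys k.
      1 / real (card I) * (\<Sum>i\<in>I. f (x i)) = (LINT y|sphere_measure. f y))"

text \<open>The index sets of the sums over multi-indices above are finite.\<close>

lemma finite_multiindices_le: "finite {\<alpha> :: 'm::finite \<Rightarrow> nat. sum \<alpha> UNIV \<le> k}"
proof (rule finite_subset)
  show "{\<alpha> :: 'm \<Rightarrow> nat. sum \<alpha> UNIV \<le> k} \<subseteq> Pi\<^sub>E UNIV (\<lambda>_. {..k})"
  proof safe
    fix \<alpha> :: "'m \<Rightarrow> nat" and i
    assume "sum \<alpha> UNIV \<le> k"
    moreover have "\<alpha> i \<le> sum \<alpha> UNIV"
      by (rule member_le_sum) auto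
    ultimately show "\<alpha> i \<le> k" by simp
  qed auto
  show "finite (Pi\<^sub>E (UNIV :: 'm set) (\<lambda>_. {..k}))"
    by (intro finite_PiE) auto
qed

lemma finite_multiindices_eq: "finite {\<alpha> :: 'm::finite \<Rightarrow> nat. sum \<alpha> UNIV = k}"
  by (rule finite_subset[OF _ finite_multiindices_le[of k]]) auto

text \<open>The identification of \<open>\<complex>\<^sup>d\<close> with \<open>\<real>\<^sup>2\<^sup>d\<close>.\<close>

definition real_coords :: "complex^'d \<Rightarrow> real^('d + 'd)" where
  "real_coords z = (\<chi> i. case i of Inl j \<Rightarrow> Re (z $ j) | Inr j \<Rightarrow> Im (z $ j))"

end

theory Submission
  imports Defs
begin

text \<open>
  Multiplication by \<open>\<omega>\<close> acts on polynomials of bidegree \<open>(p, q)\<close> as the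
  scalar \<open>\<omega>\<^sup>p cnj \<omega>\<^sup>q\<close>. For \<open>p \<noteq> q\<close> and \<open>p + q \<le> k\<close> this is a
  \<open>(k+1)\<close>-th root of unity different from 1, so both the average over the rotated design and
  the integral vanish. For \<open>p = q\<close> the scalar is 1 and \<open>p \<le> t\<close>, so the claim reduces to the
  original design; here a bihomogeneous polynomial has to be replaced by a sum of harmonic ones
  with the same restriction to the sphere.
\<close>

section \<open>Polynomials in \<open>z\<close> and its conjugate\<close>

text \<open>The central statement, \<open>rotated_design_monom_span\<close>, concerns every
  polynomial with \<open>p + q \<le> k\<close>: written in z and its conjugate, a real polynomial of
  degree at most k is a sum of such bihomogeneous terms, which need not be harmonic. Both design
  conclusions are instances of it. Integrals over the sphere enter through invariance alone; none is
  computed. Multiplication by \<open>\<omega>\<close> and the identification of C^d with R^{2d} are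
  both surjective linear isometries, so one invariance lemma, stated between two possibly different
  Euclidean spaces, serves both.\<close>

definition monom_cnj :: "('d \<Rightarrow> nat) \<Rightarrow> ('d \<Rightarrow> nat) \<Rightarrow> complex^'d \<Rightarrow> complex" where
  "monom_cnj \<alpha> \<beta> z = (\<Prod>i\<in>UNIV. (z $ i) ^ \<alpha> i) * (\<Prod>i\<in>UNIV. cnj (z $ i) ^ \<beta> i)"

text \<open>The closure rules let linear facts be checked on monomials by induction. The set of
  admissible bidegrees is a parameter so that one notion covers a single bidegree, total degree at
  most \<open>k\<close>, and, with \<open>UNIV\<close>, all polynomials.\<close>

inductive_set monom_span :: "(nat \<times> nat) set \<Rightarrow> (complex^'d \<Rightarrow> complex) set"
  for \<tau> :: "(nat \<times> nat) set" where
  zero: "(\<lambda>_. 0) \<in> monom_span \<tau>"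
| monom: "(sum \<alpha> UNIV, sum \<beta> UNIV) \<in> \<tau> \<Longrightarrow> monom_cnj \<alpha> \<beta> \<in> monom_span \<tau>"
| add: "f \<in> monom_span \<tau> \<Longrightarrow> g \<in> monom_span \<tau> \<Longrightarrow> (\<lambda>z. f z + g z) \<in> monom_span \<tau>"
| scale: "f \<in> monom_span \<tau> \<Longrightarrow> (\<lambda>z. c * f z) \<in> monom_span \<tau>"

lemma monom_span_sum:
  assumes "\<And>i. i \<in> S \<Longrightarrow> f i \<in> monom_span \<tau>"
  shows "(\<lambda>z. \<Sum>i\<in>S. f i z) \<in> monom_span \<tau>"
  using assms by (induction S rule: infinite_finite_induct) (auto intro: monom_span.intros)

lemma monom_span_mono:
  assumes "\<tau> \<subseteq> \<tau>'" "f \<in> monom_span \<tau>"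
  shows "f \<in> monom_span \<tau>'"
  using assms(2,1) by induction (auto intro: monom_span.intros)

lemma bihom_polys_eq_monom_span: "bihom_polys p q = (monom_span {(p, q)} :: (complex^'d \<Rightarrow> complex) set)"
proof (intro equalityI subsetI)
  fix f :: "complex^'d \<Rightarrow> complex"
  assume "f \<in> bihom_polys p q"
  then obtain c where f: "f = (\<lambda>z. \<Sum>\<alpha> | sum \<alpha> UNIV = p. \<Sum>\<beta> | sum \<beta> UNIV = q. c \<alpha> \<beta> * monom_cnj \<alpha> \<beta> z)"
    unfolding bihom_polys_def monom_cnj_def mult.assoc by auto
  show "f \<in> monom_span {(p, q)}"
    unfolding f by (intro monom_span_sum monom_span.scale monom_span.monom) auto
next
  have eq: "bihom_polys p q = {f :: complex^'d \<Rightarrow> complex. \<exists>c. f = (\<lambda>z. \<Sum>\<alpha> | sum \<alpha> UNIV = p. \<Sum>\<beta> | sum \<beta> UNIV = q. c \<alpha> \<beta> * monom_cnj \<alpha> \<beta> z)}"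
    unfolding bihom_polys_def monom_cnj_def mult.assoc by auto
  fix f :: "complex^'d \<Rightarrow> complex"
  assume "f \<in> monom_span {(p, q)}"
  then show "f \<in> bihom_polys p q"
  proof induction
    case zero
    show ?case unfolding eq by (auto intro!: exI[of _ "\<lambda>_ _. 0"])
  next
    case (monom \<alpha>' \<beta>')
    have "(\<Sum>\<alpha> | sum \<alpha> UNIV = p. \<Sum>\<beta> | sum \<beta> UNIV = q.
        (if \<alpha> = \<alpha>' then if \<beta> = \<beta>' then 1 else 0 else 0) * monom_cnj \<alpha> \<beta> z) = monom_cnj \<alpha>' \<beta>' z" for z
    proof -
      have "(\<Sum>\<alpha> | sum \<alpha> UNIV = p. \<Sum>\<beta> | sum \<beta> UNIV = q.
        (if \<alpha> = \<alpha>' then if \<beta> = \<beta>' then 1 else 0 else 0) * monom_cnj \<alpha> \<beta> z) =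
        (\<Sum>\<alpha> | sum \<alpha> UNIV = p. if \<alpha> = \<alpha>' then \<Sum>\<beta> | sum \<beta> UNIV = q. if \<beta> = \<beta>' then monom_cnj \<alpha> \<beta> z else 0 else 0)"
        by (intro sum.cong refl) (auto intro!: sum.cong)
      also have "\<dots> = monom_cnj \<alpha>' \<beta>' z"
        using monom by (subst sum.delta) (auto simp: finite_multiindices_eq sum.delta)
      finally show ?thesis .
    qed
    then show ?case unfolding eq by (auto intro!: exI[of _ "\<lambda>\<alpha> \<beta>. if \<alpha> = \<alpha>' then if \<beta> = \<beta>' then 1 else 0 else 0"])
  next
    case (add f g)
    then obtain c c' where "f = (\<lambda>z. \<Sum>\<alpha> | sum \<alpha> UNIV = p. \<Sum>\<beta> | sum \<beta> UNIV = q. c \<alpha> \<beta> * monom_cnj \<alpha> \<beta> z)"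
      "g = (\<lambda>z. \<Sum>\<alpha> | sum \<alpha> UNIV = p. \<Sum>\<beta> | sum \<beta> UNIV = q. c' \<alpha> \<beta> * monom_cnj \<alpha> \<beta> z)"
      unfolding eq by auto
    then show ?case unfolding eq
      by (auto intro!: exI[of _ "\<lambda>\<alpha> \<beta>. c \<alpha> \<beta> + c' \<alpha> \<beta>"] simp: sum.distrib algebra_simps)
  next
    case (scale f a)
    then obtain c where "f = (\<lambda>z. \<Sum>\<alpha> | sum \<alpha> UNIV = p. \<Sum>\<beta> | sum \<beta> UNIV = q. c \<alpha> \<beta> * monom_cnj \<alpha> \<beta> z)"
      unfolding eq by auto
    then show ?case unfolding eq
      by (auto intro!: exI[of _ "\<lambda>\<alpha> \<beta>. a * c \<alpha> \<beta>"] simp: sum_distrib_left algebra_simps)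
  qed
qed

lemma monom_cnj_mult:
  "monom_cnj \<alpha> \<beta> z * monom_cnj \<alpha>' \<beta>' z = monom_cnj (\<lambda>i. \<alpha> i + \<alpha>' i) (\<lambda>i. \<beta> i + \<beta>' i) z"
  by (simp add: monom_cnj_def power_add prod.distrib)

text \<open>Bilinearity reduces the claim to two monomials, hence the nested induction. Products of
  real coordinates are handled this way later.\<close>

lemma monom_span_mult:
  assumes "f \<in> monom_span \<sigma>" "g \<in> monom_span \<tau>"
    and "\<And>p q p' q'. (p, q) \<in> \<sigma> \<Longrightarrow> (p', q') \<in> \<tau> \<Longrightarrow> (p + p', q + q') \<in> \<rho>"
  shows "(\<lambda>z. f z * g z) \<in> monom_span \<rho>"
  using assms(1)
proof induction
  case (monom \<alpha> \<beta>)
  show ?case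
    using assms(2)
  proof induction
    case (monom \<alpha>' \<beta>')
    show ?case
      unfolding monom_cnj_mult using assms(3)[OF \<open>(sum \<alpha> UNIV, sum \<beta> UNIV) \<in> \<sigma>\<close> monom]
      by (intro monom_span.monom) (simp add: sum.distrib)
  qed (auto simp: distrib_left mult.left_commute[of "monom_cnj \<alpha> \<beta> _"] intro: monom_span.intros)
qed (auto simp: distrib_right mult.assoc intro: monom_span.intros)

lemma monom_span_scalar_mult:
  assumes "f \<in> monom_span {(p, q)}"
  shows "f (c *s z) = c ^ p * cnj c ^ q * f z"
  using assms
  by induction (auto simp: monom_cnj_def power_mult_distrib prod.distrib power_sum algebra_simps)

lemma continuous_on_monom_span:
  assumes "f \<in> monom_span \<tau>"
  shows "continuous_on UNIV f"
  using assms by induction (auto simp: monom_cnj_def[abs_def] intro!: continuous_intros)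

section \<open>Harmonic decomposition\<close>

definition dir_deriv :: "'a::real_normed_vector \<Rightarrow> ('a \<Rightarrow> 'b::real_normed_vector) \<Rightarrow> 'a \<Rightarrow> 'b" where
  "dir_deriv b f x = vector_derivative (\<lambda>r. f (x + r *\<^sub>R b)) (at 0)"

lemma has_vector_derivative_at_shift_0:
  "(g has_vector_derivative D) (at s) \<longleftrightarrow> ((\<lambda>r. g (s + r)) has_vector_derivative D) (at 0)"
proof
  have "((\<lambda>r. r + s) has_vector_derivative 1) (at 0)"
    by (auto intro!: derivative_eq_intros)
  moreover assume "(g has_vector_derivative D) (at s)"
  then have "(g has_vector_derivative D) (at (0 + s))" by simp
  ultimately show "((\<lambda>r. g (s + r)) has_vector_derivative D) (at 0)"
    using vector_diff_chain_at[of "\<lambda>r. r + s" 1 0 g D] by (simp add: o_def add.commute)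
next
  have "((\<lambda>r. r - s) has_vector_derivative 1) (at s)"
    by (auto intro!: derivative_eq_intros)
  moreover assume "((\<lambda>r. g (s + r)) has_vector_derivative D) (at 0)"
  ultimately show "(g has_vector_derivative D) (at s)"
    using vector_diff_chain_at[of "\<lambda>r. r - s" 1 s "\<lambda>r. g (s + r)" D] by (simp add: o_def)
qed

text \<open>The inner derivative at parameter \<open>s\<close> is the directional derivative at the
  shifted point \<open>x + s *\<^sub>R b\<close>. The nested one-variable derivatives thus become an
  iterated operator, to which linearity applies.\<close>

lemma laplacian_eq_dir_deriv: "laplacian f x = (\<Sum>b\<in>Basis. dir_deriv b (dir_deriv b f) x)"
proof -
  have "vector_derivative (\<lambda>r. f (x + r *\<^sub>R b)) (at s) = dir_deriv b f (x + s *\<^sub>R b)" for b s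
    unfolding dir_deriv_def vector_derivative_def
    by (subst has_vector_derivative_at_shift_0) (simp add: algebra_simps)
  then show ?thesis
    unfolding laplacian_def by (simp add: dir_deriv_def[of _ "dir_deriv _ _"])
qed

lemma sum_Basis_complex_vec:
  fixes g :: "complex^'d \<Rightarrow> 'a::comm_monoid_add"
  shows "(\<Sum>b\<in>Basis. g b) = (\<Sum>i\<in>UNIV. g (axis i 1) + g (axis i \<i>))"
proof -
  have B: "Basis = (\<Union>i\<in>UNIV. {axis i (1::complex), axis i \<i>} :: (complex^'d) set)"
    by (auto simp: Basis_vec_def Basis_complex_def)
  show ?thesis
    unfolding B by (subst sum.UNION_disjoint) (auto simp: axis_eq_axis)
qed

text \<open>Isolates coordinate \<open>i\<close>: the remaining product does not see the exponents
  at \<open>i\<close>, so differentiating along that axis or multiplying by |z_i|^2 is a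
  one-variable computation.\<close>

lemma monom_cnj_update:
  "monom_cnj (\<alpha>(i := a)) (\<beta>(i := b)) z =
    (z $ i) ^ a * cnj (z $ i) ^ b * (\<Prod>j\<in>-{i}. (z $ j) ^ \<alpha> j * cnj (z $ j) ^ \<beta> j)"
proof -
  have "(\<Prod>j\<in>UNIV. (z $ j) ^ (\<alpha>(i := a)) j * cnj (z $ j) ^ (\<beta>(i := b)) j) =
      (z $ i) ^ a * cnj (z $ i) ^ b *
      (\<Prod>j\<in>UNIV - {i}. (z $ j) ^ (\<alpha>(i := a)) j * cnj (z $ j) ^ (\<beta>(i := b)) j)"
    by (subst prod.remove[of _ i]) auto
  also have "(\<Prod>j\<in>UNIV - {i}. (z $ j) ^ (\<alpha>(i := a)) j * cnj (z $ j) ^ (\<beta>(i := b)) j) =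
      (\<Prod>j\<in>-{i}. (z $ j) ^ \<alpha> j * cnj (z $ j) ^ \<beta> j)"
    by (intro prod.cong) auto
  finally show ?thesis
    by (simp add: monom_cnj_def prod.distrib)
qed

text \<open>Wirtinger form: the derivative in direction u is u times the z_i-derivative plus
  \<open>cnj u\<close> times the derivative in the conjugate of z_i. Where an exponent is 0, the
  truncated subtraction is harmless because its coefficient vanishes.\<close>

lemma has_vector_derivative_monom_cnj_axis:
  "((\<lambda>r. monom_cnj \<alpha> \<beta> (z + r *\<^sub>R axis i u)) has_vector_derivative
    of_nat (\<alpha> i) * u * monom_cnj (\<alpha>(i := \<alpha> i - 1)) \<beta> z +
    of_nat (\<beta> i) * cnj u * monom_cnj \<alpha> (\<beta>(i := \<beta> i - 1)) z) (at 0)"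
proof -
  define R where "R = (\<Prod>j\<in>-{i}. (z $ j) ^ \<alpha> j * cnj (z $ j) ^ \<beta> j)"
  have M: "monom_cnj \<alpha> \<beta> (z + r *\<^sub>R axis i u) =
      (z $ i + of_real r * u) ^ \<alpha> i * (cnj (z $ i) + of_real r * cnj u) ^ \<beta> i * R" for r
  proof -
    have "(\<Prod>j\<in>-{i}. ((z + r *\<^sub>R axis i u) $ j) ^ \<alpha> j * cnj ((z + r *\<^sub>R axis i u) $ j) ^ \<beta> j) = R"
      unfolding R_def by (intro prod.cong) (auto simp: axis_def)
    then show ?thesis
      using monom_cnj_update[of \<alpha> i "\<alpha> i" \<beta> "\<beta> i" "z + r *\<^sub>R axis i u"]
      by (simp add: scaleR_conv_of_real[where 'a = complex])
  qed
  have 1: "monom_cnj (\<alpha>(i := a)) \<beta> z = (z $ i) ^ a * cnj (z $ i) ^ \<beta> i * R" for a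
    using monom_cnj_update[of \<alpha> i a \<beta> "\<beta> i" z] by (simp add: R_def)
  have 2: "monom_cnj \<alpha> (\<beta>(i := b)) z = (z $ i) ^ \<alpha> i * cnj (z $ i) ^ b * R" for b
    using monom_cnj_update[of \<alpha> i "\<alpha> i" \<beta> b z] by (simp add: R_def)
  have lin: "((\<lambda>r. (w + of_real r * u) ^ n) has_vector_derivative of_nat n * u * w ^ (n - 1)) (at 0)"
    for w u :: complex and n
  proof -
    have "((\<lambda>r. (w + r * u) ^ n) has_field_derivative of_nat n * u * w ^ (n - 1)) (at (of_real 0))"
      by (auto intro!: derivative_eq_intros)
    from has_vector_derivative_real_field[OF this] show ?thesis
      by (simp add: o_def)
  qed
  show ?thesis
    unfolding M 1 2
    using has_vector_derivative_mult_left[OF has_vector_derivative_mult[OF lin[of "z $ i" u "\<alpha> i"] lin[of "cnj (z $ i)" "cnj u" "\<beta> i"]], of R]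
    by (simp add: algebra_simps)
qed

lemma dir_deriv_monom_cnj:
  "dir_deriv (axis i u) (monom_cnj \<alpha> \<beta>) z =
    of_nat (\<alpha> i) * u * monom_cnj (\<alpha>(i := \<alpha> i - 1)) \<beta> z +
    of_nat (\<beta> i) * cnj u * monom_cnj \<alpha> (\<beta>(i := \<beta> i - 1)) z"
  unfolding dir_deriv_def
  by (rule vector_derivative_at[OF has_vector_derivative_monom_cnj_axis])

text \<open>\<open>vector_derivative\<close> is a choice term, so its sum and scalar rules require
  differentiability first.\<close>

lemma monom_span_has_dir_deriv:
  assumes "f \<in> monom_span \<tau>"
  shows "((\<lambda>r. f (z + r *\<^sub>R axis i u)) has_vector_derivative dir_deriv (axis i u) f z) (at 0)"
proof -
  have "\<exists>D. ((\<lambda>r. f (z + r *\<^sub>R axis i u)) has_vector_derivative D) (at 0)"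
    using assms
  proof induction
    case (monom \<alpha> \<beta>)
    then show ?case using has_vector_derivative_monom_cnj_axis by blast
  next
    case (add f g)
    then show ?case using has_vector_derivative_add by blast
  next
    case (scale f c)
    then show ?case using has_vector_derivative_mult_right by blast
  qed (auto intro: exI[of _ 0])
  then show ?thesis
    unfolding dir_deriv_def using vector_derivative_at by fastforce
qed

lemma dir_deriv_zero: "dir_deriv b (\<lambda>_. 0) = (\<lambda>_. 0)"
  by (rule ext) (simp add: dir_deriv_def)

lemma dir_deriv_add:
  assumes "f \<in> monom_span \<tau>" "g \<in> monom_span \<tau>'"
  shows "dir_deriv (axis i u) (\<lambda>z. f z + g z) =
    (\<lambda>z. dir_deriv (axis i u) f z + dir_deriv (axis i u) g z)"
  by (rule ext, subst dir_deriv_def)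
    (intro vector_derivative_at has_vector_derivative_add monom_span_has_dir_deriv[OF assms(1)]
      monom_span_has_dir_deriv[OF assms(2)])

lemma dir_deriv_scale:
  assumes "f \<in> monom_span \<tau>"
  shows "dir_deriv (axis i u) (\<lambda>z. c * f z) = (\<lambda>z. c * dir_deriv (axis i u) f z)"
  by (rule ext, subst dir_deriv_def)
    (intro vector_derivative_at has_vector_derivative_mult_right monom_span_has_dir_deriv[OF assms])

text \<open>A derivative mixes two bidegrees, so the bidegree is forgotten here; membership serves
  to differentiate a second time.\<close>

lemma dir_deriv_monom_span:
  assumes "f \<in> monom_span \<tau>"
  shows "dir_deriv (axis i u) f \<in> monom_span UNIV"
  using assms
proof induction
  case (monom \<alpha> \<beta>)
  then show ?case
    unfolding dir_deriv_monom_cnj[abs_def] by (intro monom_span.intros) auto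
qed (simp_all add: dir_deriv_zero dir_deriv_add dir_deriv_scale monom_span.intros)

lemma laplacian_zero: "laplacian (\<lambda>_. 0) = (\<lambda>_. 0)"
  by (rule ext) (simp add: laplacian_eq_dir_deriv dir_deriv_zero)

lemma laplacian_add:
  assumes "f \<in> monom_span \<tau>" "g \<in> monom_span \<tau>'"
  shows "laplacian (\<lambda>z. f z + g z) = (\<lambda>z. laplacian f z + laplacian g z)"
  by (rule ext)
    (simp add: laplacian_eq_dir_deriv sum_Basis_complex_vec dir_deriv_add[OF assms]
      dir_deriv_add[OF dir_deriv_monom_span[OF assms(1)] dir_deriv_monom_span[OF assms(2)]]
      sum.distrib algebra_simps)

lemma laplacian_scale:
  assumes "f \<in> monom_span \<tau>"
  shows "laplacian (\<lambda>z. c * f z) = (\<lambda>z. c * laplacian f z)"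
  by (rule ext)
    (simp add: laplacian_eq_dir_deriv sum_Basis_complex_vec dir_deriv_scale[OF assms]
      dir_deriv_scale[OF dir_deriv_monom_span[OF assms]] sum_distrib_left distrib_left)

lemma laplacian_sum:
  assumes "\<And>i. i \<in> S \<Longrightarrow> f i \<in> monom_span \<tau>"
  shows "laplacian (\<lambda>z. \<Sum>i\<in>S. f i z) = (\<lambda>z. \<Sum>i\<in>S. laplacian (f i) z)"
  using assms
proof (induction S rule: infinite_finite_induct)
  case (insert x F)
  then show ?case
    using laplacian_add[of "f x" \<tau> "\<lambda>z. \<Sum>i\<in>F. f i z" \<tau>] by (simp add: monom_span_sum)
qed (simp_all add: laplacian_zero)

text \<open>The Laplacian is 4 times the sum of the mixed Wirtinger derivatives: each of the
  directions \<open>1\<close> and \<open>\<i>\<close> contributes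
  \<open>2 * (u * cnj u) = 2\<close>, hence the 4.\<close>

lemma laplacian_monom_cnj:
  "laplacian (monom_cnj \<alpha> \<beta>) z = 4 * (\<Sum>i\<in>UNIV. of_nat (\<alpha> i * \<beta> i) *
    monom_cnj (\<alpha>(i := \<alpha> i - 1)) (\<beta>(i := \<beta> i - 1)) z)"
proof -
  have M: "monom_cnj \<alpha> \<beta> \<in> monom_span UNIV" for \<alpha> \<beta> :: "'a \<Rightarrow> nat"
    by (intro monom_span.monom) auto
  \<comment> \<open>The pure terms cancel when summing over \<open>u = 1\<close> and \<open>u = \<i>\<close>.\<close>
  have "dir_deriv (axis i u) (dir_deriv (axis i u) (monom_cnj \<alpha> \<beta>)) z =
      u\<^sup>2 * (of_nat (\<alpha> i) * of_nat (\<alpha> i - 1) * monom_cnj (\<alpha>(i := \<alpha> i - 1 - 1)) \<beta> z) +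
      2 * (u * cnj u) * (of_nat (\<alpha> i * \<beta> i) *
        monom_cnj (\<alpha>(i := \<alpha> i - 1)) (\<beta>(i := \<beta> i - 1)) z) +
      (cnj u)\<^sup>2 * (of_nat (\<beta> i) * of_nat (\<beta> i - 1) * monom_cnj \<alpha> (\<beta>(i := \<beta> i - 1 - 1)) z)"
    for i u
    unfolding dir_deriv_monom_cnj[abs_def] dir_deriv_add[OF monom_span.scale[OF M] monom_span.scale[OF M]]
      dir_deriv_scale[OF M]
    by (simp add: dir_deriv_monom_cnj algebra_simps power2_eq_square)
  then show ?thesis
    unfolding laplacian_eq_dir_deriv sum_Basis_complex_vec sum_distrib_left
    by (intro sum.cong refl) (simp add: algebra_simps)
qed

lemma sum_fun_upd_Suc: "sum (\<alpha>(i := Suc (\<alpha> i))) UNIV = Suc (sum \<alpha> (UNIV :: 'd::finite set))"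
  by (simp add: sum.remove[of UNIV i] if_distrib cong: if_cong)

lemma sum_fun_upd_pred:
  fixes \<alpha> :: "'d::finite \<Rightarrow> nat"
  assumes "\<alpha> i > 0"
  shows "sum (\<alpha>(i := \<alpha> i - 1)) UNIV = sum \<alpha> UNIV - 1"
  using sum_fun_upd_Suc[of "\<alpha>(i := \<alpha> i - 1)" i] assms by (simp add: fun_upd_idem)

lemma laplacian_monom_span:
  assumes "f \<in> monom_span {(Suc p, Suc q)}"
  shows "laplacian f \<in> monom_span {(p, q)}"
  using assms
proof induction
  case (monom \<alpha> \<beta>)
  have "(\<lambda>z. of_nat (\<alpha> i * \<beta> i) * monom_cnj (\<alpha>(i := \<alpha> i - 1)) (\<beta>(i := \<beta> i - 1)) z)
      \<in> monom_span {(p, q)}" for i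
  \<comment> \<open>If an exponent is 0, truncated subtraction produces the wrong bidegree, and the
    vanishing coefficient must be used instead.\<close>
  proof (cases "\<alpha> i * \<beta> i = 0")
    case True
    then show ?thesis by (simp only: True of_nat_0 mult_zero_left monom_span.zero)
  next
    case False
    then have "sum (\<alpha>(i := \<alpha> i - 1)) UNIV = p" "sum (\<beta>(i := \<beta> i - 1)) UNIV = q"
      using monom sum_fun_upd_pred[of \<alpha> i] sum_fun_upd_pred[of \<beta> i] by auto
    then show ?thesis by (intro monom_span.intros) auto
  qed
  then show ?case
    unfolding laplacian_monom_cnj[abs_def] by (rule monom_span.scale[OF monom_span_sum])
qed (simp_all add: laplacian_zero laplacian_add laplacian_scale monom_span.intros)

text \<open>Holomorphic and antiholomorphic polynomials are harmonic, as no coordinate carries both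
  exponents. These are the base cases of the decomposition.\<close>

lemma laplacian_eq_0_monom_span:
  assumes "f \<in> monom_span {(p, q)}" "p = 0 \<or> q = 0"
  shows "laplacian f = (\<lambda>_. 0)"
  using assms(1)
proof induction
  case (monom \<alpha> \<beta>)
  then have "\<alpha> i * \<beta> i = 0" for i
    using assms(2) by auto
  then show ?case
    unfolding laplacian_monom_cnj[abs_def] by (simp only: of_nat_0 mult_zero_left sum.neutral_const mult_zero_right)
qed (simp_all add: laplacian_zero laplacian_add laplacian_scale)

section \<open>Multiplication by |z|^2 and its commutator with the Laplacian\<close>

definition norm_sq :: "complex^'d \<Rightarrow> complex" where
  "norm_sq z = (\<Sum>i\<in>UNIV. z $ i * cnj (z $ i))"

lemma norm_sq_eq: "norm_sq z = of_real ((norm z)\<^sup>2)"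
  by (simp add: norm_sq_def norm_vec_def L2_set_def sum_nonneg complex_norm_square flip: of_real_power)

lemma monom_cnj_mult_coord:
  "z $ i * cnj (z $ i) * monom_cnj \<alpha> \<beta> z =
    monom_cnj (\<alpha>(i := Suc (\<alpha> i))) (\<beta>(i := Suc (\<beta> i))) z"
  using monom_cnj_update[of \<alpha> i "\<alpha> i" \<beta> "\<beta> i" z] by (simp add: monom_cnj_update)

lemma norm_sq_mult_monom_span:
  assumes "f \<in> monom_span {(p, q)}"
  shows "(\<lambda>z. norm_sq z * f z) \<in> monom_span {(Suc p, Suc q)}"
  using assms
proof induction
  case (monom \<alpha> \<beta>)
  then show ?case
    unfolding norm_sq_def sum_distrib_right monom_cnj_mult_coord
    by (intro monom_span_sum monom_span.monom) (auto simp: sum_fun_upd_Suc simp del: fun_upd_apply)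
qed (simp_all add: distrib_left mult.left_commute[of "norm_sq _"] monom_span.intros)

lemma norm_sq_power_mult_monom_span:
  assumes "f \<in> monom_span {(p, q)}"
  shows "(\<lambda>z. norm_sq z ^ j * f z) \<in> monom_span {(p + j, q + j)}"
  by (induction j) (simp_all add: assms mult.assoc norm_sq_mult_monom_span)

text \<open>In coordinate i, \<open>(a + 1) * (b + 1) = a * b + (a + b + 1)\<close>; summing
  \<open>\<alpha> i + \<beta> i + 1\<close> over the coordinates gives p + q + d, and the 4 is that
  of the Laplacian.\<close>

lemma laplacian_norm_sq_mult:
  fixes f :: "complex^'d \<Rightarrow> complex"
  assumes "f \<in> monom_span {(p, q)}"
  shows "laplacian (\<lambda>z. norm_sq z * f z) =
    (\<lambda>z. norm_sq z * laplacian f z + 4 * of_nat (p + q + CARD('d)) * f z)"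
  using assms
proof induction
  case zero
  show ?case by (simp add: laplacian_zero)
next
  case (monom \<alpha> \<beta>)
  have step: "laplacian (monom_cnj (\<alpha>(i := Suc (\<alpha> i))) (\<beta>(i := Suc (\<beta> i)))) z =
      z $ i * cnj (z $ i) * laplacian (monom_cnj \<alpha> \<beta>) z
      + 4 * of_nat (\<alpha> i + \<beta> i + 1) * monom_cnj \<alpha> \<beta> z" (is "?L = ?R") for i z
  proof -
    let ?a = "\<alpha>(i := Suc (\<alpha> i))" and ?b = "\<beta>(i := Suc (\<beta> i))"
    have summand: "of_nat (?a l * ?b l) * monom_cnj (?a(l := ?a l - 1)) (?b(l := ?b l - 1)) z =
        z $ i * cnj (z $ i) * (of_nat (\<alpha> l * \<beta> l) * monom_cnj (\<alpha>(l := \<alpha> l - 1)) (\<beta>(l := \<beta> l - 1)) z)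
        + (if l = i then of_nat (\<alpha> i + \<beta> i + 1) * monom_cnj \<alpha> \<beta> z else 0)" for l
    proof (cases "l = i")
      case True
      \<comment> \<open>Raising after lowering restores the exponents only when both are positive;
        otherwise both sides vanish.\<close>
      have "of_nat (\<alpha> i * \<beta> i) * (z $ i * cnj (z $ i) * monom_cnj (\<alpha>(i := \<alpha> i - 1)) (\<beta>(i := \<beta> i - 1)) z)
          = of_nat (\<alpha> i * \<beta> i) * monom_cnj \<alpha> \<beta> z"
        by (cases "\<alpha> i * \<beta> i = 0") (auto simp: monom_cnj_mult_coord)
      then show ?thesis using True by (auto simp: algebra_simps)
    next
      case False
      then show ?thesis
        using monom_cnj_mult_coord[of z i "\<alpha>(l := \<alpha> l - 1)" "\<beta>(l := \<beta> l - 1)"]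
        by (simp add: fun_upd_twist[of l i] mult.left_commute)
    qed
    show ?thesis
      unfolding laplacian_monom_cnj summand sum.distrib sum.delta[OF finite]
      by (simp add: sum_distrib_left algebra_simps)
  qed
  show ?case
  proof
    fix z
    have "laplacian (\<lambda>z. norm_sq z * monom_cnj \<alpha> \<beta> z) z =
        (\<Sum>i\<in>UNIV. laplacian (monom_cnj (\<alpha>(i := Suc (\<alpha> i))) (\<beta>(i := Suc (\<beta> i)))) z)"
      unfolding norm_sq_def sum_distrib_right monom_cnj_mult_coord
      by (subst laplacian_sum[where \<tau> = UNIV]) (auto intro: monom_span.monom)
    also have "\<dots> = (\<Sum>i\<in>UNIV. z $ i * cnj (z $ i) * laplacian (monom_cnj \<alpha> \<beta>) z)
        + (\<Sum>i\<in>UNIV. 4 * of_nat (\<alpha> i + \<beta> i + 1) * monom_cnj \<alpha> \<beta> z)"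
      unfolding step by (rule sum.distrib)
    also have "\<dots> = norm_sq z * laplacian (monom_cnj \<alpha> \<beta>) z
        + 4 * of_nat (\<Sum>i\<in>UNIV. \<alpha> i + \<beta> i + 1) * monom_cnj \<alpha> \<beta> z"
      by (simp only: norm_sq_def of_nat_sum sum_distrib_left sum_distrib_right)
    also have "(\<Sum>i\<in>UNIV. \<alpha> i + \<beta> i + 1) = p + q + CARD('d)"
      using monom by (simp only: sum.distrib) simp
    finally show "laplacian (\<lambda>z. norm_sq z * monom_cnj \<alpha> \<beta> z) z = norm_sq z * laplacian (monom_cnj \<alpha> \<beta>) z
        + 4 * of_nat (p + q + CARD('d)) * monom_cnj \<alpha> \<beta> z" .
  qed
next
  case (add f g)
  then show ?case
    using laplacian_add[OF norm_sq_mult_monom_span[OF add.hyps(1)] norm_sq_mult_monom_span[OF add.hyps(2)]]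
    by (simp add: laplacian_add[OF add.hyps] algebra_simps)
next
  case (scale f c)
  then show ?case
    using laplacian_scale[OF norm_sq_mult_monom_span[OF scale.hyps], of c]
    by (simp add: laplacian_scale[OF scale.hyps] algebra_simps)
qed

text \<open>Iterating the commutator identity on a harmonic \<open>h\<close> adds a positive
  constant at each step, so the factor is never 0 and can be divided out in the
  decomposition.\<close>

lemma laplacian_norm_sq_power_mult:
  fixes h :: "complex^'d \<Rightarrow> complex"
  assumes h: "h \<in> monom_span {(p, q)}" and harm: "laplacian h = (\<lambda>_. 0)"
  shows "\<exists>c>0. laplacian (\<lambda>z. norm_sq z ^ Suc j * h z) = (\<lambda>z. of_nat c * (norm_sq z ^ j * h z))"
proof (induction j)
  case 0
  show ?case
    using laplacian_norm_sq_mult[OF h]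
    by (intro exI[of _ "4 * (p + q + CARD('d))"]) (simp add: harm mult.assoc)
next
  case (Suc j)
  then obtain c where c: "laplacian (\<lambda>z. norm_sq z ^ Suc j * h z) = (\<lambda>z. of_nat c * (norm_sq z ^ j * h z))"
    by blast
  \<comment> \<open>The increment comes from \<open>norm_sq z ^ Suc j * h z\<close> having bidegree
    \<open>(p + Suc j, q + Suc j)\<close>.\<close>
  show ?case
    using laplacian_norm_sq_mult[OF norm_sq_power_mult_monom_span[OF h, of "Suc j"]]
    unfolding c
    by (intro exI[of _ "c + 4 * (p + Suc j + (q + Suc j) + CARD('d))"]) (simp add: algebra_simps)
qed

text \<open>
  Induction on the bidegree: \<open>laplacian f\<close> already has a decomposition with summands
  \<open>|z|\<^sup>2\<^sup>j h\<^sub>j\<close>. Each summand is, up to a positive factor, the Laplacian of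
  \<open>|z|\<^sup>2\<^sup>j\<^sup>+\<^sup>2 h\<^sub>j\<close>, so subtracting these from \<open>f\<close> leaves a harmonic polynomial.
\<close>

lemma harmonic_decomposition:
  assumes "f \<in> monom_span {(p, q)}"
  shows "\<exists>h. (\<forall>j\<le>min p q. h j \<in> monom_span {(p - j, q - j)} \<and> laplacian (h j) = (\<lambda>_. 0)) \<and>
    f = (\<lambda>z. \<Sum>j\<le>min p q. norm_sq z ^ j * h j z)"
  using assms
proof (induction p arbitrary: q f)
  case 0
  then show ?case
    using laplacian_eq_0_monom_span[OF 0] by (intro exI[of _ "\<lambda>_. f"]) auto
next
  case (Suc p)
  show ?case
  proof (cases q)
    case 0
    then show ?thesis
      using Suc.prems laplacian_eq_0_monom_span[OF Suc.prems] by (intro exI[of _ "\<lambda>_. f"]) auto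
  next
    case q: (Suc q')
    let ?m = "min p q'"
    from Suc.IH[OF laplacian_monom_span[OF Suc.prems[unfolded q]]]
    obtain h where lap: "laplacian f = (\<lambda>z. \<Sum>j\<le>?m. norm_sq z ^ j * h j z)"
      and h: "\<And>j. j \<le> ?m \<Longrightarrow> h j \<in> monom_span {(p - j, q' - j)}"
        "\<And>j. j \<le> ?m \<Longrightarrow> laplacian (h j) = (\<lambda>_. 0)"
      by blast
    have "\<exists>c>0. laplacian (\<lambda>z. norm_sq z ^ Suc j * h j z) = (\<lambda>z. of_nat c * (norm_sq z ^ j * h j z))"
      if "j \<le> ?m" for j
      using laplacian_norm_sq_power_mult[OF h[OF that]] .
    then obtain c :: "nat \<Rightarrow> nat" where c: "c j > 0"
      "laplacian (\<lambda>z. norm_sq z ^ Suc j * h j z) = (\<lambda>z. of_nat (c j) * (norm_sq z ^ j * h j z))" if "j \<le> ?m" for j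
      by metis
    define h' where "h' j z = inverse (of_nat (c j)) * h j z" for j z
    have h': "h' j \<in> monom_span {(p - j, q' - j)}" "laplacian (h' j) = (\<lambda>_. 0)" if "j \<le> ?m" for j
      unfolding h'_def[abs_def] using h[OF that] by (auto intro: monom_span.scale simp: laplacian_scale[OF h(1)[OF that]])
    define u where "u z = (\<Sum>j\<le>?m. norm_sq z ^ Suc j * h' j z)" for z
    have ms: "(\<lambda>z. norm_sq z ^ Suc j * g z) \<in> monom_span {(Suc p, Suc q')}"
      if "j \<le> ?m" "g \<in> monom_span {(p - j, q' - j)}" for j g
      using norm_sq_power_mult_monom_span[OF that(2), of "Suc j"] that(1) by simp
    have u: "u \<in> monom_span {(Suc p, Suc q')}"
      unfolding u_def[abs_def] using ms h' by (intro monom_span_sum) auto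
    have lapu: "laplacian u = laplacian f"
    proof -
      have "laplacian u = (\<lambda>z. \<Sum>j\<le>?m. laplacian (\<lambda>z. norm_sq z ^ Suc j * h' j z) z)"
        unfolding u_def[abs_def] using ms h' by (intro laplacian_sum) auto
      also have "\<dots> = (\<lambda>z. \<Sum>j\<le>?m. norm_sq z ^ j * h j z)"
      proof (intro ext sum.cong refl)
        fix z j assume "j \<in> {..?m}"
        then have j: "j \<le> ?m" by simp
        have "(\<lambda>z. norm_sq z ^ Suc j * h' j z) = (\<lambda>z. inverse (of_nat (c j)) * (norm_sq z ^ Suc j * h j z))"
          by (simp add: h'_def algebra_simps)
        then show "laplacian (\<lambda>z. norm_sq z ^ Suc j * h' j z) z = norm_sq z ^ j * h j z"
          using c[OF j] by (simp add: laplacian_scale[OF ms[OF j h(1)[OF j]]] del: power_Suc)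
      qed
      finally show ?thesis using lap by simp
    qed
    define h0 where "h0 z = f z + (-1) * u z" for z
    have h0: "h0 \<in> monom_span {(Suc p, q)}" "laplacian h0 = (\<lambda>_. 0)"
    proof -
      show "h0 \<in> monom_span {(Suc p, q)}"
        unfolding h0_def[abs_def] using Suc.prems u q by (intro monom_span.add monom_span.scale) auto
      show "laplacian h0 = (\<lambda>_. 0)"
        unfolding h0_def[abs_def]
        using laplacian_add[OF Suc.prems monom_span.scale[OF u], of "-1"] laplacian_scale[OF u, of "-1"] lapu
        by simp
    qed
    have m: "min (Suc p) q = Suc ?m" using q by simp
    show ?thesis
    \<comment> \<open>The harmonic remainder \<open>h0\<close> takes index 0, and the extra factor
      |z|^2 moves \<open>h' j\<close> to index \<open>Suc j\<close>, where its bidegree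
      \<open>(p - j, q' - j)\<close> reads \<open>(Suc p - Suc j, Suc q' - Suc j)\<close>.\<close>
    proof (intro exI[of _ "case_nat h0 h'"] conjI allI impI)
      show "f = (\<lambda>z. \<Sum>j\<le>min (Suc p) q. norm_sq z ^ j * case_nat h0 h' j z)"
        unfolding m sum.atMost_Suc_shift by (rule ext) (simp add: h0_def u_def)
    qed (use h0 h' m q in \<open>auto split: nat.split\<close>)
  qed
qed

section \<open>Isometry invariance of the surface measure\<close>

lemma nn_integral_lborel_translate:
  fixes f :: "'a::euclidean_space \<Rightarrow> ennreal"
  assumes [measurable]: "f \<in> borel_measurable borel"
  shows "(\<integral>\<^sup>+x. f (c + x) \<partial>lborel) = (\<integral>\<^sup>+x. f x \<partial>lborel)"
  by (subst (2) lborel_distr_plus[of c, symmetric], subst nn_integral_distr) auto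

text \<open>
  Both sides equal the double integral of \<open>1\<^sub>A(T x) 1\<^sub>B(y - T x)\<close>, where \<open>B\<close> is the unit ball:
  translate in \<open>y\<close> for the left-hand side, and by a preimage of \<open>y\<close> in \<open>x\<close> for the right-hand side.
\<close>

lemma emeasure_lborel_vimage_linear_isometry:
  fixes T :: "'a::euclidean_space \<Rightarrow> 'b::euclidean_space"
  assumes T: "linear T" "\<And>x. norm (T x) = norm x" "surj T" and A[measurable]: "A \<in> sets borel"
  shows "emeasure lborel (T -` A) * emeasure lborel (ball (0::'b) 1) =
    emeasure lborel A * emeasure lborel (ball (0::'a) 1)"
proof -
  have [measurable]: "T \<in> borel_measurable borel"
    using T(1) by (intro borel_measurable_continuous_onI linear_continuous_on linear_conv_bounded_linear[THEN iffD1])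
  have vA[measurable]: "T -` A \<in> sets borel"
    using measurable_sets[OF \<open>T \<in> borel_measurable borel\<close> A] by simp
  have [measurable]: "ball (0::'b) 1 \<in> sets borel" "ball (0::'a) 1 \<in> sets borel"
    by simp_all
  have "emeasure lborel (T -` A) * emeasure lborel (ball (0::'b) 1) =
      (\<integral>\<^sup>+x. indicator A (T x) * emeasure lborel (ball (0::'b) 1) \<partial>lborel)"
    by (subst nn_integral_multc) (auto simp: indicator_vimage[symmetric] o_def simp flip: nn_integral_indicator intro!: nn_integral_cong split: split_indicator)
  also have "\<dots> = (\<integral>\<^sup>+x. \<integral>\<^sup>+y. indicator A (T x) * indicator (ball 0 1) (y - T x) \<partial>lborel \<partial>lborel)"
  proof (rule nn_integral_cong)
    fix x
    have "(\<lambda>y. indicator (ball 0 1) (y - T x) :: ennreal) \<in> borel_measurable lborel"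
      by measurable
    then have "(\<integral>\<^sup>+y. indicator A (T x) * indicator (ball 0 1) (y - T x) \<partial>lborel) =
        indicator A (T x) * (\<integral>\<^sup>+y. indicator (ball 0 1) (- T x + y) \<partial>lborel)"
      by (simp add: nn_integral_cmult)
    also have "(\<integral>\<^sup>+y. indicator (ball 0 1) (- T x + y) \<partial>lborel) = emeasure lborel (ball (0::'b) 1)"
      by (subst nn_integral_lborel_translate) auto
    finally show "indicator A (T x) * emeasure lborel (ball (0::'b) 1) =
        (\<integral>\<^sup>+y. indicator A (T x) * indicator (ball 0 1) (y - T x) \<partial>lborel)" ..
  qed
  also have "\<dots> = (\<integral>\<^sup>+y. \<integral>\<^sup>+x. indicator A (T x) * indicator (ball 0 1) (y - T x) \<partial>lborel \<partial>lborel)"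
    by (intro lborel_pair.Fubini') measurable
  also have "\<dots> = (\<integral>\<^sup>+y. \<integral>\<^sup>+x. indicator A (y + T x) * indicator (ball 0 1) x \<partial>lborel \<partial>lborel)"
  proof (rule nn_integral_cong)
    fix y
    obtain c where c: "T c = y" using T(3) by (metis surjD)
    have "(\<integral>\<^sup>+x. indicator A (T x) * indicator (ball 0 1) (y - T x) \<partial>lborel) =
      (\<integral>\<^sup>+x. indicator A (T (c + x)) * indicator (ball 0 1) (y - T (c + x)) \<partial>lborel)"
      by (subst nn_integral_lborel_translate[of "\<lambda>x. indicator A (T x) * indicator (ball 0 1) (y - T x)"]) auto
    \<comment> \<open>Since \<open>y - T (c + x) = - T x\<close> has the norm of \<open>x\<close>,
      the unit ball of the target turns into that of the source.\<close>
    also have "\<dots> = (\<integral>\<^sup>+x. indicator A (y + T x) * indicator (ball 0 1) x \<partial>lborel)"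
      by (intro nn_integral_cong) (simp add: linear_add[OF T(1)] c T(2) indicator_def)
    finally show "(\<integral>\<^sup>+x. indicator A (T x) * indicator (ball 0 1) (y - T x) \<partial>lborel) =
      (\<integral>\<^sup>+x. indicator A (y + T x) * indicator (ball 0 1) x \<partial>lborel)" .
  qed
  also have "\<dots> = (\<integral>\<^sup>+x. \<integral>\<^sup>+y. indicator A (y + T x) * indicator (ball 0 1) x \<partial>lborel \<partial>lborel)"
    by (intro lborel_pair.Fubini') measurable
  also have "\<dots> = (\<integral>\<^sup>+x. emeasure lborel A * indicator (ball (0::'a) 1) x \<partial>lborel)"
  proof (rule nn_integral_cong)
    fix x :: 'a
    have "(\<integral>\<^sup>+y. indicator A (y + T x) * indicator (ball 0 1) x \<partial>lborel) =
        (\<integral>\<^sup>+y. indicator A (T x + y) \<partial>lborel) * indicator (ball 0 1) x"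
      by (subst nn_integral_multc) (auto simp: add.commute)
    also have "(\<integral>\<^sup>+y. indicator A (T x + y) \<partial>lborel) = emeasure lborel A"
      by (subst nn_integral_lborel_translate) auto
    finally show "(\<integral>\<^sup>+y. indicator A (y + T x) * indicator (ball 0 1) x \<partial>lborel) =
      emeasure lborel A * indicator (ball (0::'a) 1) x" .
  qed
  also have "\<dots> = emeasure lborel A * emeasure lborel (ball (0::'a) 1)"
    by (subst nn_integral_cmult) auto
  finally show ?thesis .
qed

text \<open>An isometry carries the uniform distribution on one ball to that on the other, and it
  commutes with \<open>sgn\<close>, the radial projection that defines the surface measure.\<close>

lemma distr_sphere_measure_linear_isometry:
  fixes T :: "'a::euclidean_space \<Rightarrow> 'b::euclidean_space"
  assumes T: "linear T" "\<And>x. norm (T x) = norm x" "surj T"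
  shows "distr sphere_measure borel T = sphere_measure"
proof -
  have [measurable]: "T \<in> borel_measurable borel"
    using T(1) by (intro borel_measurable_continuous_onI linear_continuous_on linear_conv_bounded_linear[THEN iffD1])
  have [measurable]: "(sgn :: 'c::euclidean_space \<Rightarrow> 'c) \<in> borel_measurable borel"
    by (simp add: sgn_div_norm[abs_def])
  have U: "distr (uniform_measure lborel (ball 0 1)) borel T = uniform_measure lborel (ball 0 1)"
  proof (rule measure_eqI)
    fix A :: "'b set" assume "A \<in> sets (distr (uniform_measure lborel (ball 0 1)) borel T)"
    then have A[measurable]: "A \<in> sets borel" by simp
    have vA[measurable]: "T -` A \<in> sets borel"
      using measurable_sets[OF \<open>T \<in> borel_measurable borel\<close> A] by simp
    define a b m n where "a = emeasure lborel (ball 0 1 \<inter> T -` A)" "b = emeasure lborel (ball 0 1 \<inter> A)"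
      "m = emeasure lborel (ball (0::'a) 1)" "n = emeasure lborel (ball (0::'b) 1)"
    note abmn = this
    have "T -` (ball 0 1 \<inter> A) = ball 0 1 \<inter> T -` A" by (auto simp: T(2))
    then have eq: "a * n = b * m"
      using emeasure_lborel_vimage_linear_isometry[OF T, of "ball 0 1 \<inter> A"] by (simp add: abmn)
    \<comment> \<open>The relation \<open>a * n = b * m\<close> becomes an equality of quotients in
      \<open>ennreal\<close> because both ball volumes are nonzero and finite.\<close>
    have pos: "emeasure lborel (ball (0::'c::euclidean_space) 1) \<noteq> 0"
      using content_ball_pos[of 1 "0::'c"] by (auto simp: measure_def)
    have fin: "emeasure lborel (ball (0::'c::euclidean_space) 1) \<noteq> top"
      using emeasure_lborel_ball_finite[of "0::'c" 1] by auto
    have mn: "m \<noteq> 0" "n \<noteq> 0" "m \<noteq> top" "n \<noteq> top"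
      unfolding abmn using pos fin by auto
    have inv: "m * inverse m = 1" "n * inverse n = 1"
      using mn ennreal_mult_divide_eq[of m 1] ennreal_mult_divide_eq[of n 1]
      by (simp_all add: divide_ennreal_def)
    have "a * inverse m = a * n * inverse n * inverse m"
      using inv(2) by (simp add: mult.assoc)
    also have "\<dots> = b * inverse n"
      using inv(1) unfolding eq by (simp add: mult.assoc mult.left_commute[of m])
    finally have "a / m = b / n"
      by (simp add: divide_ennreal_def)
    then show "emeasure (distr (uniform_measure lborel (ball 0 1)) borel T) A =
        emeasure (uniform_measure lborel (ball 0 1)) A"
      by (simp add: emeasure_distr abmn)
  qed simp
  have "T \<circ> sgn = sgn \<circ> T"
    by (auto simp: sgn_div_norm linear_scale[OF T(1)] T(2))
  then have "distr sphere_measure borel T =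
      distr (distr (uniform_measure lborel (ball 0 1)) borel T) borel sgn"
    unfolding sphere_measure_def by (simp add: distr_distr)
  then show ?thesis
    unfolding U sphere_measure_def .
qed

lemma integral_sphere_measure_linear_isometry:
  fixes T :: "'a::euclidean_space \<Rightarrow> 'b::euclidean_space"
    and f :: "'b \<Rightarrow> 'c::{banach, second_countable_topology}"
  assumes T: "linear T" "\<And>x. norm (T x) = norm x" "surj T"
    and f[measurable]: "f \<in> borel_measurable borel"
  shows "(LINT x|sphere_measure. f (T x)) = (LINT y|sphere_measure. f y)"
proof -
  have [measurable]: "T \<in> borel_measurable borel"
    using T(1) by (intro borel_measurable_continuous_onI linear_continuous_on linear_conv_bounded_linear[THEN iffD1])
  have "T \<in> sphere_measure \<rightarrow>\<^sub>M borel"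
    unfolding sphere_measure_def by simp
  from integral_distr[OF this f] show ?thesis
    by (simp add: distr_sphere_measure_linear_isometry[OF T])
qed

text \<open>The measure is a probability measure carried by the compact sphere, on which a
  continuous function is bounded.\<close>

lemma integrable_sphere_measure:
  fixes f :: "'a::euclidean_space \<Rightarrow> 'b::{banach, second_countable_topology}"
  assumes "continuous_on UNIV f"
  shows "integrable sphere_measure f"
proof -
  interpret prob_space "sphere_measure :: 'a measure"
    by (rule prob_space_sphere_measure)
  have "compact (f ` sphere 0 1)"
    using assms by (intro compact_continuous_image) (auto intro: continuous_on_subset)
  then obtain B where "\<And>x. x \<in> sphere 0 1 \<Longrightarrow> norm (f x) \<le> B"
    using compact_imp_bounded bounded_iff by (metis imageI)
  then have "AE x in sphere_measure. norm (f x) \<le> B"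
    using AE_sphere_measure by (auto elim: eventually_mono)
  moreover have "f \<in> borel_measurable sphere_measure"
    using borel_measurable_continuous_onI[OF assms] unfolding sphere_measure_def by simp
  ultimately show ?thesis
    by (intro integrable_const_bound)
qed

section \<open>Unimodular scalars and real coordinates as isometries\<close>

lemma norm_scalar_mult: "norm (c *s z) = cmod c * norm (z :: complex^'d)"
  by (simp add: norm_vec_def L2_set_def norm_mult power_mult_distrib real_sqrt_mult flip: sum_distrib_left)

lemma integral_sphere_measure_scalar_mult:
  fixes f :: "complex^'d \<Rightarrow> complex"
  assumes "continuous_on UNIV f" "cmod c = 1"
  shows "(LINT z|sphere_measure. f (c *s z)) = (LINT z|sphere_measure. f z)"
proof (rule integral_sphere_measure_linear_isometry)
  show "linear ((*s) c :: complex^'d \<Rightarrow> _)"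
    by (rule linearI) (simp_all add: vec_eq_iff algebra_simps)
  show "surj ((*s) c :: complex^'d \<Rightarrow> _)"
  proof (rule surjI)
    show "c *s (inverse c *s z) = z" for z :: "complex^'d"
      using assms(2) by (cases "c = 0") (auto simp: vec_eq_iff)
  qed
qed (use assms in \<open>auto simp: norm_scalar_mult intro: borel_measurable_continuous_onI\<close>)

lemma norm_real_coords: "norm (real_coords z) = norm z"
proof -
  have "(\<Sum>i\<in>UNIV. (real_coords z $ i)\<^sup>2) = (\<Sum>i\<in>UNIV. (cmod (z $ i))\<^sup>2)"
    unfolding UNIV_Plus_UNIV[symmetric]
    by (subst sum.Plus) (auto simp: real_coords_def cmod_power2 sum.distrib)
  then show ?thesis
    by (simp add: norm_vec_def L2_set_def)
qed

lemma integral_sphere_measure_real_coords: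
  fixes f :: "real^('d::finite + 'd) \<Rightarrow> real"
  assumes "f \<in> borel_measurable borel"
  shows "(LINT z|sphere_measure. f (real_coords (z :: complex^'d))) = (LINT y|sphere_measure. f y)"
proof (rule integral_sphere_measure_linear_isometry)
  show "linear (real_coords :: complex^'d \<Rightarrow> _)"
    by (rule linearI) (auto simp: real_coords_def vec_eq_iff split: sum.split)
  show "surj (real_coords :: complex^'d \<Rightarrow> _)"
  proof (rule surjI)
    show "real_coords (\<chi> j. Complex (y $ Inl j) (y $ Inr j)) = y" for y
      by (auto simp: real_coords_def vec_eq_iff split: sum.split)
  qed
qed (use assms in \<open>auto simp: norm_real_coords\<close>)

section \<open>Rotated designs\<close>

text \<open>Powers of |z|^2 are 1 on the sphere, so \<open>f\<close> agrees there with a sum of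
  harmonic polynomials of bidegrees \<open>(s - j, s - j)\<close>, and \<open>s - j \<le> t\<close>
  puts all of them within reach of the hypothesis.\<close>

lemma tt_design_bihom:
  fixes x :: "'i \<Rightarrow> complex^'d"
  assumes des: "tt_design t I x" and "s \<le> t" and f: "f \<in> monom_span {(s, s)}"
  shows "(\<Sum>i\<in>I. f (x i)) = of_nat (card I) * (LINT z|sphere_measure. f z)"
proof -
  obtain \<tau> where \<tau>: "{(s, s) | s. s \<le> t} \<subseteq> \<tau>" "tau_design \<tau> I x"
    using des unfolding tt_design_def by blast
  obtain h where h: "\<And>j. j \<le> s \<Longrightarrow> h j \<in> monom_span {(s - j, s - j)}"
      "\<And>j. j \<le> s \<Longrightarrow> laplacian (h j) = (\<lambda>_. 0)"
    and f_eq: "f = (\<lambda>z. \<Sum>j\<le>s. norm_sq z ^ j * h j z)"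
    using harmonic_decomposition[OF f] by auto
  define F where "F = (\<lambda>j. (j, j)) ` {..s}"
  \<comment> \<open>\<open>harmonic_sum\<close> indexes summands by bidegree; the one of bidegree
    \<open>(p, p)\<close> is \<open>h (s - p)\<close>.\<close>
  define g where "g = (\<lambda>pq :: nat \<times> nat. h (s - fst pq))"
  define H where "H z = (\<Sum>pq\<in>F. g pq z)" for z
  have "H \<in> harmonic_sum \<tau>"
    unfolding harmonic_sum_def
  proof (intro CollectI exI conjI)
    show "finite F" "F \<subseteq> \<tau>"
      using \<tau>(1) \<open>s \<le> t\<close> by (auto simp: F_def)
    show "\<forall>(p, q)\<in>F. g (p, q) \<in> harmonic_polys p q"
    proof safe
      fix p q assume "(p, q) \<in> F"
      then have "q = p" "p \<le> s" by (auto simp: F_def)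
      then show "g (p, q) \<in> harmonic_polys p q"
        using h[of "s - p"] by (simp add: g_def harmonic_polys_def bihom_polys_eq_monom_span)
    qed
    show "H = (\<lambda>z. \<Sum>pq\<in>F. g pq z)"
      by (rule ext) (rule H_def)
  qed
  then have *: "1 / of_nat (card I) * (\<Sum>i\<in>I. H (x i)) = (LINT z|sphere_measure. H z)"
    and I: "finite I" "I \<noteq> {}" "\<forall>i\<in>I. x i \<in> sphere 0 1"
    using \<tau>(2) unfolding tau_design_def by auto
  have H_eq: "H z = (\<Sum>j\<le>s. h j z)" for z
    unfolding H_def F_def g_def
    by (subst sum.reindex) (auto simp: inj_on_def intro!: sum.reindex_bij_witness[of _ "\<lambda>j. s - j" "\<lambda>j. s - j"])
  have fH: "f z = H z" if "z \<in> sphere 0 1" for z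
    using that by (simp add: f_eq H_eq norm_sq_eq)
  have [measurable]: "f \<in> borel_measurable sphere_measure" "H \<in> borel_measurable sphere_measure"
  proof -
    show "f \<in> borel_measurable sphere_measure"
      using integrable_sphere_measure[OF continuous_on_monom_span[OF f]] by auto
    have "integrable sphere_measure H"
      unfolding H_eq[abs_def]
      by (intro Bochner_Integration.integrable_sum integrable_sphere_measure continuous_on_monom_span[OF h(1)]) auto
    then show "H \<in> borel_measurable sphere_measure" by auto
  qed
  have "(LINT z|sphere_measure. f z) = (LINT z|sphere_measure. H z)"
    using AE_sphere_measure fH by (intro integral_cong_AE) (auto elim: eventually_mono)
  moreover have "(\<Sum>i\<in>I. f (x i)) = (\<Sum>i\<in>I. H (x i))"
    using fH I(3) by (intro sum.cong) auto
  ultimately show ?thesis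
    using * I(1,2) by (simp add: field_simps)
qed

text \<open>On the unit circle conjugation is inversion, so the product is \<open>\<omega>\<close>
  to the power |p - q|, or its conjugate. That exponent lies between 1 and k and is therefore not
  divisible by k + 1, the order of \<open>\<omega>\<close>.\<close>

lemma root_unity_power_cnj_neq_1:
  assumes \<omega>: "\<omega> = exp (2 * of_real pi * \<i> / of_nat (k + 1))" and "p \<noteq> q" "p + q \<le> k"
  shows "\<omega> ^ p * cnj \<omega> ^ q \<noteq> 1"
proof -
  have norm: "cmod \<omega> = 1"
    by (simp add: \<omega>)
  have pw: "\<omega> ^ m \<noteq> 1" if "0 < m" "m \<le> k" for m
  proof -
    have "\<omega> ^ m = exp (2 * of_real pi * \<i> * of_nat m / of_nat (k + 1))"
      unfolding \<omega> exp_of_nat_mult[symmetric] by (simp add: field_simps)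
    then show ?thesis
      using complex_root_unity_eq_1[of "k + 1" m] that by (auto dest: dvd_imp_le)
  qed
  have 1: "\<omega> * cnj \<omega> = 1"
    using norm by (simp add: complex_norm_square[symmetric])
  show ?thesis
  proof (cases "q < p")
    case True
    then have "\<omega> ^ p * cnj \<omega> ^ q = \<omega> ^ (p - q) * (\<omega> * cnj \<omega>) ^ q"
      by (simp add: power_mult_distrib flip: power_add mult.assoc)
    then show ?thesis using pw[of "p - q"] True assms(3) by (simp add: 1)
  next
    case False
    then have "\<omega> ^ p * cnj \<omega> ^ q = cnj (\<omega> ^ (q - p)) * (\<omega> * cnj \<omega>) ^ p"
      using power_add[of "cnj \<omega>" "q - p" p] by (simp add: power_mult_distrib ac_simps)
    moreover have "cnj (\<omega> ^ (q - p)) \<noteq> cnj 1"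
      using pw[of "q - p"] False assms(2,3) unfolding complex_cnj_cancel_iff by simp
    ultimately show ?thesis by (simp add: 1)
  qed
qed

lemma rotated_design_bihom:
  fixes x :: "'i \<Rightarrow> complex^'d"
  assumes des: "tt_design t I x" and "k \<le> 2 * t + 1"
    and \<omega>: "\<omega> = exp (2 * of_real pi * \<i> / of_nat (k + 1))"
    and f: "f \<in> monom_span {(p, q)}" and "p + q \<le> k"
  shows "(\<Sum>(a, j)\<in>{0..k} \<times> I. f (\<omega> ^ a *s x j)) =
    of_nat (card ({0..k} \<times> I)) * (LINT z|sphere_measure. f z)"
proof -
  define \<xi> where "\<xi> = \<omega> ^ p * cnj \<omega> ^ q"
  have norm: "cmod \<omega> = 1"
    by (simp add: \<omega>)
  have rot: "f (\<omega> ^ a *s z) = \<xi> ^ a * f z" for a z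
    unfolding monom_span_scalar_mult[OF f] \<xi>_def
    by (simp add: power_mult_distrib power_mult[symmetric] mult.commute)
  \<comment> \<open>The double sum factors into a geometric sum and the sum over the original
    design. The geometric sum is 0 off the diagonal and k + 1 on it.\<close>
  have sum_eq: "(\<Sum>(a, j)\<in>{0..k} \<times> I. f (\<omega> ^ a *s x j)) = (\<Sum>a=0..k. \<xi> ^ a) * (\<Sum>j\<in>I. f (x j))"
    unfolding rot by (simp add: sum.cartesian_product[symmetric] sum_product)
  show ?thesis
  proof (cases "p = q")
    case True
    then have "\<xi> = 1"
      using norm by (simp add: \<xi>_def complex_norm_square[symmetric] flip: power_mult_distrib)
    \<comment> \<open>By parity \<open>2 * p \<le> 2 * t + 1\<close> already gives
      \<open>p \<le> t\<close>; this is where the bound on \<open>k\<close> comes from.\<close>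
    moreover have "p \<le> t" using True \<open>p + q \<le> k\<close> \<open>k \<le> 2 * t + 1\<close> by simp
    ultimately show ?thesis
      unfolding sum_eq using tt_design_bihom[OF des, of p f] f True by (simp add: card_cartesian_product algebra_simps)
  next
    case False
    then have "\<xi> \<noteq> 1"
      unfolding \<xi>_def using root_unity_power_cnj_neq_1[OF \<omega>] \<open>p + q \<le> k\<close> by blast
    have "\<omega> ^ Suc k = 1"
      using complex_root_unity[of "k + 1" 1] by (simp add: \<omega>)
    then have "cnj \<omega> ^ Suc k = 1"
      by (metis complex_cnj_power complex_cnj_one)
    moreover have "\<xi> ^ Suc k = (\<omega> ^ Suc k) ^ p * (cnj \<omega> ^ Suc k) ^ q"
      by (simp only: \<xi>_def power_mult_distrib power_mult[symmetric] mult.commute)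
    ultimately have "\<xi> ^ Suc k = 1"
      using \<open>\<omega> ^ Suc k = 1\<close> by simp
    then have "(\<Sum>a=0..k. \<xi> ^ a) = 0"
      using sum_gp_basic[of \<xi> k] \<open>\<xi> \<noteq> 1\<close> by (simp add: atMost_atLeast0)
    moreover have "(LINT z|sphere_measure. f z) = 0"
    proof -
      \<comment> \<open>Invariance under \<open>\<omega>\<close> makes the integral equal to
        \<open>\<xi>\<close> times itself.\<close>
      have "(LINT z|sphere_measure. f z) = (LINT z|sphere_measure. f (\<omega> *s z))"
        by (rule integral_sphere_measure_scalar_mult[symmetric, OF continuous_on_monom_span[OF f] norm])
      also have "\<dots> = \<xi> * (LINT z|sphere_measure. f z)"
        using rot[of 1] by simp
      finally show ?thesis using \<open>\<xi> \<noteq> 1\<close> by simp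
    qed
    ultimately show ?thesis by (simp add: sum_eq)
  qed
qed

lemma rotated_design_monom_span:
  fixes x :: "'i \<Rightarrow> complex^'d"
  assumes des: "tt_design t I x" and k: "k \<le> 2 * t + 1"
    and \<omega>: "\<omega> = exp (2 * of_real pi * \<i> / of_nat (k + 1))"
    and f: "f \<in> monom_span {(p, q). p + q \<le> k}"
  shows "(\<Sum>(a, j)\<in>{0..k} \<times> I. f (\<omega> ^ a *s x j)) =
    of_nat (card ({0..k} \<times> I)) * (LINT z|sphere_measure. f z)"
  using f
proof induction
  case (monom \<alpha> \<beta>)
  then show ?case
    by (intro rotated_design_bihom[OF des k \<omega>, of _ "sum \<alpha> UNIV" "sum \<beta> UNIV"] monom_span.monom) auto
next
  case (add f g)
  note int = integrable_sphere_measure[OF continuous_on_monom_span]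
  show ?case
    using add.IH by (simp add: int[OF add.hyps(1)] int[OF add.hyps(2)] case_prod_unfold sum.distrib distrib_left)
next
  case (scale f c)
  then show ?case
    by (simp add: case_prod_unfold sum_distrib_left[symmetric])
qed simp

section \<open>Harmonic sums and real polynomials as polynomials in z and its conjugate\<close>

lemma harmonic_sum_monom_span:
  assumes "f \<in> harmonic_sum \<tau>"
  shows "f \<in> monom_span \<tau>"
proof -
  obtain F g where F: "F \<subseteq> \<tau>" "\<And>p q. (p, q) \<in> F \<Longrightarrow> g (p, q) \<in> harmonic_polys p q"
    and f: "f = (\<lambda>z. \<Sum>pq\<in>F. g pq z)"
    using assms unfolding harmonic_sum_def by blast
  show ?thesis
    unfolding f
  proof (rule monom_span_sum)
    fix pq assume pq: "pq \<in> F"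
    then have "g pq \<in> monom_span {pq}"
      using F(2)[of "fst pq" "snd pq"] by (simp add: harmonic_polys_def bihom_polys_eq_monom_span)
    then show "g pq \<in> monom_span \<tau>"
      by (rule monom_span_mono[rotated]) (use pq F(1) in auto)
  qed
qed

lemma monom_span_degree_power:
  assumes "f \<in> monom_span {(p, q). p + q \<le> m}"
  shows "(\<lambda>z. f z ^ n) \<in> monom_span {(p, q). p + q \<le> m * n}"
proof (induction n)
  case 0
  have "(monom_cnj (\<lambda>_. 0) (\<lambda>_. 0) :: complex^'a \<Rightarrow> complex) \<in> monom_span {(p, q). p + q \<le> 0}"
    by (rule monom_span.monom) auto
  then show ?case by (simp add: monom_cnj_def[abs_def])
next
  case (Suc n)
  show ?case
    unfolding power_Suc by (rule monom_span_mult[OF assms Suc.IH]) auto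
qed

lemma monom_span_degree_prod:
  assumes "\<And>i. i \<in> S \<Longrightarrow> f i \<in> monom_span {(p, q). p + q \<le> m i}"
  shows "(\<lambda>z. \<Prod>i\<in>S. f i z) \<in> monom_span {(p, q). p + q \<le> sum m S}"
proof -
  have one: "(\<lambda>_. 1) \<in> monom_span {(p, q). p + q \<le> 0}"
    using monom_span_degree_power[OF monom_span.zero, of 0 0] by simp
  show ?thesis
    using assms
  proof (induction S rule: infinite_finite_induct)
    case (insert i S)
    then have "(\<lambda>z. f i z * (\<Prod>i\<in>S. f i z)) \<in> monom_span {(p, q). p + q \<le> m i + sum m S}"
      by (intro monom_span_mult[where \<sigma> = "{(p, q). p + q \<le> m i}" and \<tau> = "{(p, q). p + q \<le> sum m S}"]) auto
    then show ?case using insert.hyps by simp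
  qed (use one in simp_all)
qed

lemma real_coords_monom_span:
  "(\<lambda>z. of_real (real_coords z $ i)) \<in> monom_span {(p, q). p + q \<le> 1}"
proof -
  define e :: "'a \<Rightarrow> 'a \<Rightarrow> nat" where "e j = (\<lambda>l. if l = j then 1 else 0)" for j
  have z: "(\<lambda>z. z $ j) \<in> monom_span {(p, q). p + q \<le> 1}"
    and cz: "(\<lambda>z. cnj (z $ j)) \<in> monom_span {(p, q). p + q \<le> 1}" for j :: 'a
  proof -
    have 1: "(\<Prod>l\<in>UNIV. w l ^ e j l) = w j" for w :: "'a \<Rightarrow> complex"
      unfolding e_def by (simp add: if_distrib prod.delta cong: if_cong)
    have "monom_cnj (e j) (\<lambda>_. 0) \<in> monom_span {(p, q). p + q \<le> 1}"
      by (rule monom_span.monom) (simp add: e_def)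
    then show "(\<lambda>z. z $ j) \<in> monom_span {(p, q). p + q \<le> 1}"
      by (simp add: monom_cnj_def[abs_def] 1)
    have "monom_cnj (\<lambda>_. 0) (e j) \<in> monom_span {(p, q). p + q \<le> 1}"
      by (rule monom_span.monom) (simp add: e_def)
    then show "(\<lambda>z. cnj (z $ j)) \<in> monom_span {(p, q). p + q \<le> 1}"
      by (simp add: monom_cnj_def[abs_def] 1)
  qed
  show ?thesis
  proof (cases i)
    case (Inl j)
    have "(\<lambda>z. 1 / 2 * (z $ j + cnj (z $ j))) \<in> monom_span {(p, q). p + q \<le> 1}"
      by (intro monom_span.scale monom_span.add z cz)
    then show ?thesis
      by (simp add: Inl real_coords_def complex_add_cnj)
  next
    case (Inr j)
    have "(\<lambda>z. 1 / (2 * \<i>) * (z $ j + (- 1) * cnj (z $ j))) \<in> monom_span {(p, q). p + q \<le> 1}"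
      by (intro monom_span.scale monom_span.add z cz)
    also have "(\<lambda>z. 1 / (2 * \<i>) * (z $ j + (- 1) * cnj (z $ j))) = (\<lambda>z. of_real (real_coords z $ i))"
      by (auto simp: Inr real_coords_def complex_eq_iff)
    finally show ?thesis .
  qed
qed

lemma real_polys_monom_span:
  assumes "f \<in> real_polys k"
  shows "(\<lambda>z. of_real (f (real_coords z))) \<in> monom_span {(p, q). p + q \<le> k}"
proof -
  obtain c where f: "f = (\<lambda>x. \<Sum>\<alpha> | sum \<alpha> UNIV \<le> k. c \<alpha> * (\<Prod>i\<in>UNIV. (x $ i) ^ \<alpha> i))"
    using assms unfolding real_polys_def by blast
  have "(\<lambda>z. \<Prod>i\<in>UNIV. complex_of_real (real_coords z $ i) ^ \<alpha> i) \<in> monom_span {(p, q). p + q \<le> k}"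
    if "sum \<alpha> UNIV \<le> k" for \<alpha>
    by (rule monom_span_mono[OF _ monom_span_degree_prod[where m = "\<lambda>i. 1 * \<alpha> i"]])
      (use that in \<open>auto intro: monom_span_degree_power[OF real_coords_monom_span, simplified]\<close>)
  then show ?thesis
    unfolding f of_real_sum of_real_mult of_real_prod of_real_power
    by (intro monom_span_sum monom_span.scale) auto
qed

lemma continuous_on_real_polys:
  assumes "f \<in> real_polys k"
  shows "continuous_on UNIV f"
proof -
  obtain c where f: "f = (\<lambda>x. \<Sum>\<alpha> | sum \<alpha> UNIV \<le> k. c \<alpha> * (\<Prod>i\<in>UNIV. (x $ i) ^ \<alpha> i))"
    using assms unfolding real_polys_def by blast
  show ?thesis
    unfolding f by (intro continuous_intros)
qed

lemma mean_eqI: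
  fixes S L :: "'a::field_char_0"
  assumes "n \<noteq> 0" "S = of_nat n * L"
  shows "1 / of_nat n * S = L"
  using assms by simp

theorem mainTheorem7:
  fixes v :: "nat \<Rightarrow> complex^'d" and n t k :: nat and \<omega> :: complex
  assumes "tt_design t {1..n} v"
    and "k \<le> 2 * t + 1"
    and "\<omega> = exp (2 * of_real pi * \<i> / of_nat (k + 1))"
  shows "card ({0..k} \<times> {1..n}) = (k + 1) * n \<and>
    complex_design k ({0..k} \<times> {1..n}) (\<lambda>(a, j). \<omega> ^ a *s v j) \<and>
    real_design k ({0..k} \<times> {1..n}) (\<lambda>(a, j). real_coords (\<omega> ^ a *s v j))"
proof (intro conjI)
  let ?I = "{0..k} \<times> {1..n}"
  show "card ?I = (k + 1) * n"
    by (simp add: card_cartesian_product)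
  have fin: "finite ?I" by simp
  \<comment> \<open>\<open>tau_design\<close> demands a nonempty index set, so the hypothesis
    already gives \<open>n > 0\<close>.\<close>
  have ne: "?I \<noteq> {}" and v: "\<And>j. j \<in> {1..n} \<Longrightarrow> norm (v j) = 1"
    using assms(1) unfolding tt_design_def tau_design_def by auto
  then have card: "card ?I \<noteq> 0" using fin by simp
  have norm: "norm (\<omega> ^ a *s v j) = 1" if "j \<in> {1..n}" for a j
    using v[OF that] by (simp add: norm_scalar_mult norm_power assms(3))
  note main = rotated_design_monom_span[OF assms]
  have "tau_design {(p, q). p + q \<le> k} ?I (\<lambda>(a, j). \<omega> ^ a *s v j)"
    unfolding tau_design_def
  proof (intro conjI ballI fin ne)
    show "(case i of (a, j) \<Rightarrow> \<omega> ^ a *s v j) \<in> sphere 0 1" if "i \<in> ?I" for i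
      using that norm by auto
    fix f :: "complex^'d \<Rightarrow> complex" assume "f \<in> harmonic_sum {(p, q). p + q \<le> k}"
    from main[OF harmonic_sum_monom_span[OF this]]
    show "1 / of_nat (card ?I) * (\<Sum>i\<in>?I. f (case i of (a, j) \<Rightarrow> \<omega> ^ a *s v j)) =
        (LINT z|sphere_measure. f z)"
      by (intro mean_eqI card) (simp only: case_prod_unfold)
  qed
  then show "complex_design k ?I (\<lambda>(a, j). \<omega> ^ a *s v j)"
    unfolding complex_design_def by blast
  show "real_design k ?I (\<lambda>(a, j). real_coords (\<omega> ^ a *s v j))"
    unfolding real_design_def
  proof (intro conjI ballI fin ne)
    show "(case i of (a, j) \<Rightarrow> real_coords (\<omega> ^ a *s v j)) \<in> sphere 0 1" if "i \<in> ?I" for i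
      using that norm by (auto simp: norm_real_coords)
    fix f :: "real^('d + 'd) \<Rightarrow> real" assume f: "f \<in> real_polys k"
    have int: "(LINT z|sphere_measure. f (real_coords (z :: complex^'d))) = (LINT y|sphere_measure. f y)"
      using continuous_on_real_polys[OF f]
      by (intro integral_sphere_measure_real_coords borel_measurable_continuous_onI)
    \<comment> \<open>The identity is obtained for the complex-valued polynomial
      \<open>of_real (f (real_coords z))\<close>; injectivity of \<open>of_real\<close> returns it
      to the reals.\<close>
    have "complex_of_real (\<Sum>(a, j)\<in>?I. f (real_coords (\<omega> ^ a *s v j))) =
        of_real (real (card ?I) * (LINT y|sphere_measure. f y))"
      using main[OF real_polys_monom_span[OF f]]
      by (simp add: int case_prod_unfold del: card_cartesian_product)
    then have "(\<Sum>(a, j)\<in>?I. f (real_coords (\<omega> ^ a *s v j))) =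
        real (card ?I) * (LINT y|sphere_measure. f y)"
      unfolding of_real_eq_iff .
    then show "1 / real (card ?I) * (\<Sum>i\<in>?I. f (case i of (a, j) \<Rightarrow> real_coords (\<omega> ^ a *s v j))) =
        (LINT y|sphere_measure. f y)"
      by (intro mean_eqI card) (simp only: case_prod_unfold)
  qed
qed

end
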